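(* Let $k\ge \ell\ge 1$ be integers with $k+\ell\ge 6$. Then the bounds "underlying graph $(k+\ell-2)$-degenerate" and "$\chi\le k+\ell-1$" for $C(k,\ell)$-free Hamiltonian digraphs are best possible: there exists a $C(k,\ell)$-free Hamiltonian digraph $D$ with $\chi(D)=k+\ell-1$ whose underlying graph is not $(k+\ell-3)$-degenerate. In fact, any Hamiltonian tournament on $k+\ell-1$ vertices is such a digraph.
   Context: All graphs and digraphs are finite and simple (no loops, no multiple edges or arcs), except that a digraph may contain a pair of opposite arcs. The length of a directed path is its number of arcs. For positive integers $k,\ell$, the family $C(k,\ell)$ consists of all digraphs obtained from two internally vertex-disjoint directed paths, of lengths at least $k$ and at least $\ell$ respectively, by identifying their initial vertices and identifying their terminal vertices (so a member consists of two internally vertex-disjoint directed paths from a vertex $s$ to a vertex $t\ne s$, one of length at least $k$ and the other of length at least $\ell$). A digraph is $C(k,\ell)$-free if it contains no member of $C(k,\ell)$ as a subdigraph. A digraph is Hamiltonian if it contains a directed Hamiltonian cycle. The underlying graph of a digraph $D$ is the simple graph on $V(D)$ in which two vertices are adjacent whenever they are joined by at least one arc of $D$, and $\chi(D)$ is the chromatic number of the underlying graph. A graph is $d$-degenerate if each of its nonempty subgraphs has a vertex of degree at most $d$ in that subgraph. *)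

theory Defs
  imports "Graph_Theory.Graph_Theory"
begin

text \<open>
  The digraphs considered are those of the locale \<^locale>\<open>digraph\<close>: finite, without loops and
  without parallel arcs, opposite arcs being allowed. Following Graph_Theory, an undirected
  graph is a symmetric digraph (locale \<^locale>\<open>graph\<close>): an edge is a pair of opposite arcs.
\<close>

text \<open>
  A path is given by its list of arcs, so its length is \<^const>\<open>length\<close>. The paths share no arc,
  so together with \<^locale>\<open>digraph\<close> they are never both a single arc from \<open>s\<close> to \<open>t\<close>.
\<close>

definition C_family :: "nat \<Rightarrow> nat \<Rightarrow> ('a, 'b) pre_digraph set" where
  "C_family k l = {H. digraph H \<and>
     (\<exists>s t p q. s \<noteq> t \<and>
        pre_digraph.apath H s p t \<and> k \<le> length p \<and>
        pre_digraph.apath H s q t \<and> l \<le> length q \<and>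
        set (pre_digraph.inner_verts H p) \<inter> set (pre_digraph.inner_verts H q) = {} \<and>
        set p \<inter> set q = {} \<and>
        verts H = set (pre_digraph.awalk_verts H s p) \<union> set (pre_digraph.awalk_verts H s q) \<and>
        arcs H = set p \<union> set q)}"

definition C_free :: "nat \<Rightarrow> nat \<Rightarrow> ('a, 'b) pre_digraph \<Rightarrow> bool" where
  "C_free k l D \<longleftrightarrow> \<not> (\<exists>H. subgraph H D \<and> H \<in> C_family k l)"

definition hamiltonian :: "('a, 'b) pre_digraph \<Rightarrow> bool" where
  "hamiltonian D \<longleftrightarrow> (\<exists>p. pre_digraph.cycle D p \<and> tail D ` set p = verts D)"

definition tournament :: "('a, 'b) pre_digraph \<Rightarrow> bool" where
  "tournament T \<longleftrightarrow> digraph T \<and>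
     (\<forall>u \<in> verts T. \<forall>v \<in> verts T. u \<noteq> v \<longrightarrow>
        ((u, v) \<in> arcs_ends T \<longleftrightarrow> (v, u) \<notin> arcs_ends T))"

abbreviation underlying_graph :: "('a, 'b) pre_digraph \<Rightarrow> ('a, 'a \<times> 'a) pre_digraph" where
  "underlying_graph D \<equiv> with_proj (mk_symmetric D)"

definition proper_colouring :: "('a, 'b) pre_digraph \<Rightarrow> nat \<Rightarrow> ('a \<Rightarrow> nat) \<Rightarrow> bool" where
  "proper_colouring G n c \<longleftrightarrow>
     c ` verts G \<subseteq> {..<n} \<and> (\<forall>e \<in> arcs G. c (tail G e) \<noteq> c (head G e))"

definition chromatic_number :: "('a, 'b) pre_digraph \<Rightarrow> nat" where
  "chromatic_number G = (LEAST n. \<exists>c. proper_colouring G n c)"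

text \<open>
  In a symmetric digraph without parallel arcs the out-degree of a vertex is its number of
  neighbours, i.e. its degree in the graph; the subgraphs \<open>H\<close> must themselves be symmetric.
\<close>

definition degenerate :: "nat \<Rightarrow> ('a, 'b) pre_digraph \<Rightarrow> bool" where
  "degenerate d G \<longleftrightarrow>
     (\<forall>H. subgraph H G \<and> graph H \<and> verts H \<noteq> {} \<longrightarrow> (\<exists>v \<in> verts H. out_degree H v \<le> d))"

end

theory Submission
  imports Defs
begin

text \<open>
  A member of \<open>C(k,l)\<close> has at least \<open>k + l\<close> vertices, so no digraph on \<open>k + l - 1\<close> vertices
  contains one; and the underlying graph of a tournament on \<open>n\<close> vertices is \<open>K\<^sub>n\<close>.
\<close>

lemma (in wf_digraph) set_awalk_verts_inner_verts:
  assumes "apath s p t" and "s \<noteq> t"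
  shows "set (awalk_verts s p) = {s, t} \<union> set (inner_verts p)"
proof -
  have "awhd s p = s" "awlast s p = t"
    using assms(1) unfolding apath_def awalk_conv by blast+
  then have "s \<in> set (awalk_verts s p)" "t \<in> set (awalk_verts s p)"
    by (metis awalk_verts_non_Nil hd_in_set, metis awalk_verts_non_Nil last_in_set)
  then show ?thesis
    using set_inner_verts[OF assms(1)] by blast
qed

text \<open>An \<open>apath\<close> of length m visits m + 1 distinct vertices, and dropping its two
  distinct ends leaves m - 1. The form with \<open>Suc\<close> avoids truncated subtraction.\<close>

lemma (in wf_digraph) Suc_card_inner_verts:
  assumes "apath s p t" and "s \<noteq> t"
  shows "Suc (card (set (inner_verts p))) = length p"
proof -
  have "Suc (length p) = card (set (awalk_verts s p))"
    using assms(1) by (simp add: apath_def distinct_card length_awalk_verts)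
  also have "\<dots> = 2 + card (set (inner_verts p))"
  proof -
    have "s \<notin> set (inner_verts p)" "t \<notin> set (inner_verts p)"
      by (simp_all add: set_inner_verts[OF assms(1)])
    then show ?thesis
      using assms(2) by (simp add: set_awalk_verts_inner_verts[OF assms])
  qed
  finally show ?thesis
    by linarith
qed

text \<open>The two paths share exactly \<open>s\<close> and \<open>t\<close>, so the vertices
  number 2 + (length p - 1) + (length q - 1) = length p + length q.\<close>

lemma C_family_card_verts:
  assumes "H \<in> C_family k l"
  shows "k + l \<le> card (verts H)"
proof -
  obtain s t p q where dig: "digraph H" and st: "s \<noteq> t"
    and p: "pre_digraph.apath H s p t" "k \<le> length p"
    and q: "pre_digraph.apath H s q t" "l \<le> length q"
    and disj: "set (pre_digraph.inner_verts H p) \<inter> set (pre_digraph.inner_verts H q) = {}"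
    and V: "verts H = set (pre_digraph.awalk_verts H s p) \<union> set (pre_digraph.awalk_verts H s q)"
    using assms unfolding C_family_def by blast
  interpret digraph H by (fact dig)
  let ?P = "set (inner_verts p)" and ?Q = "set (inner_verts q)"
  have "verts H = {s, t} \<union> (?P \<union> ?Q)"
    using V st p(1) q(1) by (auto simp: set_awalk_verts_inner_verts)
  moreover have "{s, t} \<inter> (?P \<union> ?Q) = {}"
    using set_inner_verts[OF p(1)] set_inner_verts[OF q(1)] by blast
  ultimately have "card (verts H) = 2 + (card ?P + card ?Q)"
    using disj st by (simp add: card_Un_disjoint)
  then show ?thesis
    using Suc_card_inner_verts[OF p(1) st] Suc_card_inner_verts[OF q(1) st] p(2) q(2) by linarith
qed

lemma C_free_if_card_verts_less:
  assumes "finite (verts D)" and "card (verts D) < k + l"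
  shows "C_free k l D"
  unfolding C_free_def
proof
  assume "\<exists>H. subgraph H D \<and> H \<in> C_family k l"
  then obtain H where "subgraph H D" "H \<in> C_family k l" by blast
  then have "verts H \<subseteq> verts D" "k + l \<le> card (verts H)"
    by (auto dest: subgraph_imp_subverts C_family_card_verts)
  then show False
    using assms card_mono[of "verts D" "verts H"] by linarith
qed

lemma proper_colouring_complete_digraph_iff:
  assumes "complete_digraph n G"
  shows "proper_colouring G m c \<longleftrightarrow> c ` verts G \<subseteq> {..<m} \<and> inj_on c (verts G)"
proof -
  have ends: "arcs_ends G = {(u, v). (u, v) \<in> verts G \<times> verts G \<and> u \<noteq> v}"
    using assms by (simp add: complete_digraph_def)
  \<comment> \<open>\<open>complete_digraph\<close> describes the arcs only through their end pairs,
    so the colouring condition is first moved from arcs to pairs.\<close>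
  have "(\<forall>e \<in> arcs G. c (tail G e) \<noteq> c (head G e)) \<longleftrightarrow> (\<forall>(u, v) \<in> arcs_ends G. c u \<noteq> c v)"
    by (auto simp: arcs_ends_conv)
  also have "\<dots> \<longleftrightarrow> inj_on c (verts G)"
    unfolding ends inj_on_def by auto
  finally show ?thesis
    by (simp add: proper_colouring_def)
qed

text \<open>Proper colourings are exactly the injective ones: a numbering of the vertices uses n
  colours, and an injection into m colours forces n \<le> m.\<close>

lemma chromatic_number_complete_digraph:
  assumes "complete_digraph n G"
  shows "chromatic_number G = n"
  unfolding chromatic_number_def
proof (rule Least_equality)
  have card: "card (verts G) = n" and "graph G"
    using assms by (auto simp: complete_digraph_def)
  then interpret graph G by simp
  obtain c where "bij_betw c (verts G) {..<n}"
    using ex_bij_betw_finite_nat[OF finite_verts] card by (auto simp: atLeast0LessThan)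
  then have "proper_colouring G n c"
    by (simp add: proper_colouring_complete_digraph_iff[OF assms] bij_betw_def)
  then show "\<exists>c. proper_colouring G n c" by blast
  show "n \<le> m" if colourable: "\<exists>c. proper_colouring G m c" for m
  proof -
    obtain c where "proper_colouring G m c"
      using colourable by blast
    then have "c ` verts G \<subseteq> {..<m}" "inj_on c (verts G)"
      by (simp_all add: proper_colouring_complete_digraph_iff[OF assms])
    then show ?thesis
      using card_inj_on_le[of c "verts G" "{..<m}"] card by simp
  qed
qed

lemma out_degree_complete_digraph:
  assumes "complete_digraph n G" and "v \<in> verts G"
  shows "out_degree G v = n - 1"
proof -
  interpret graph G
    using assms(1) by (simp add: complete_digraph_def)
  \<comment> \<open>Without parallel arcs an arc is determined by its ends, so out-arcs may be
    counted as pairs.\<close>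
  have "out_degree G v = card (arc_to_ends G ` out_arcs G v)"
    unfolding out_degree_def
    by (rule card_image[symmetric], rule inj_on_subset[OF inj_on_arc_to_ends]) auto
  also have "arc_to_ends G ` out_arcs G v = {e \<in> arcs_ends G. fst e = v}"
    by (auto simp: arcs_ends_def arc_to_ends_def)
  also have "arcs_ends G = {(u, w). (u, w) \<in> verts G \<times> verts G \<and> u \<noteq> w}"
    using assms(1) by (simp add: complete_digraph_def)
  also have "{e \<in> \<dots>. fst e = v} = Pair v ` (verts G - {v})"
    using assms(2) by auto
  also have "card \<dots> = n - 1"
    using assms by (simp add: card_image inj_on_def complete_digraph_def)
  finally show ?thesis .
qed

text \<open>The violating subgraph is \<open>G\<close> itself, where every vertex has degree n - 1 >
  d.\<close>

lemma not_degenerate_complete_digraph: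
  assumes "complete_digraph n G" and "Suc d < n"
  shows "\<not> degenerate d G"
proof
  assume deg: "degenerate d G"
  have "graph G" and "verts G \<noteq> {}"
    using assms by (auto simp: complete_digraph_def)
  then interpret graph G by simp
  have "\<exists>v \<in> verts G. out_degree G v \<le> d"
    using deg[unfolded degenerate_def, rule_format, of G] subgraph_refl \<open>graph G\<close> \<open>verts G \<noteq> {}\<close>
    by simp
  then obtain v where "v \<in> verts G" "out_degree G v \<le> d" ..
  then show False
    using out_degree_complete_digraph[OF assms(1)] assms(2) by simp
qed

text \<open>Any two distinct vertices are joined in one direction and symmetrising adds the other;
  the absence of loops gives the converse inclusion.\<close>

lemma complete_underlying_graph_tournament:
  assumes "tournament T"
  shows "complete_digraph (card (verts T)) (underlying_graph T)"
proof -
  interpret digraph T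
    using assms by (simp add: tournament_def)
  have "parcs (mk_symmetric T) = arcs_ends T \<union> (arcs_ends T)\<inverse>"
    by (auto simp: parcs_mk_symmetric arcs_ends_conv)
  also have "\<dots> = {(u, v). (u, v) \<in> verts T \<times> verts T \<and> u \<noteq> v}"
  proof (intro set_eqI, clarify)
    fix u v
    have "(u, v) \<in> arcs_ends T \<union> (arcs_ends T)\<inverse> \<Longrightarrow> u \<in> verts T \<and> v \<in> verts T \<and> u \<noteq> v"
      by (metis Un_iff converse_iff adj_in_verts adj_not_same)
    moreover have "(u, v) \<in> arcs_ends T \<union> (arcs_ends T)\<inverse>"
      if "u \<in> verts T" "v \<in> verts T" "u \<noteq> v"
      using assms that unfolding tournament_def by blast
    ultimately show "(u, v) \<in> arcs_ends T \<union> (arcs_ends T)\<inverse> \<longleftrightarrow>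
        (u, v) \<in> {(u, v). (u, v) \<in> verts T \<times> verts T \<and> u \<noteq> v}"
      by blast
  qed
  finally show ?thesis
    by (simp add: complete_digraph_pair_def)
qed

text \<open>A transitive tournament with the arcs of its Hamiltonian path reversed.\<close>

definition back_tournament :: "nat \<Rightarrow> nat pair_pre_digraph" where
  "back_tournament n =
     \<lparr>pverts = {..<n}, parcs = {(i, j). i < n \<and> j < n \<and> (j = Suc i \<or> Suc j < i)}\<rparr>"

lemma back_tournament_simps [simp]:
  "pverts (back_tournament n) = {..<n}"
  "parcs (back_tournament n) = {(i, j). i < n \<and> j < n \<and> (j = Suc i \<or> Suc j < i)}"
  by (simp_all add: back_tournament_def)

text \<open>For i < j the arc (i, j) is present iff j = Suc i, and (j, i) iff Suc i < j, so exactly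
  one of them is.\<close>

lemma tournament_back_tournament: "tournament (with_proj (back_tournament n))"
proof -
  have "finite (parcs (back_tournament n))"
    by (rule finite_subset[of _ "{..<n} \<times> {..<n}"]) auto
  then interpret pair_digraph "back_tournament n"
    by unfold_locales auto
  show ?thesis
    using digraph_axioms by (auto simp: tournament_def)
qed

text \<open>Strips the ascending walk from i to j off the front. The arbitrary rest
  \<open>es\<close> leaves room for the arc that closes the Hamiltonian cycle.\<close>

lemma pcas_upt_append:
  "i \<le> j \<Longrightarrow> pcas i (map (\<lambda>m. (m, Suc m)) [i..<j] @ es) v \<longleftrightarrow> pcas j es v"
  by (induction "j - i" arbitrary: i) (auto simp: upt_conv_Cons)

lemma hamiltonian_back_tournament:
  assumes "3 \<le> n"
  shows "hamiltonian (with_proj (back_tournament n))"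
proof -
  let ?T = "with_proj (back_tournament n)"
  obtain m where m: "n = Suc m" "2 \<le> m"
    using assms by (cases n) auto
  \<comment> \<open>The cycle 0, 1, ..., m, 0. Its closing arc (m, 0) is a backward arc because Suc
    0 < m, which is where n \<ge> 3 enters.\<close>
  let ?p = "map (\<lambda>i. (i, Suc i)) [0..<m] @ [(m, 0)]"
  have "set ?p \<subseteq> arcs ?T"
    using m by auto
  moreover have "pcas 0 ?p 0"
    by (subst pcas_upt_append) auto
  ultimately have "pre_digraph.awalk ?T 0 ?p 0"
    using m by (simp add: pre_digraph.awalk_def cas_with_proj_eq)
  moreover have "pre_digraph.awalk_verts ?T 0 ?p = [0..<Suc m] @ [0]"
    by (simp add: pre_digraph.awalk_verts_conv comp_def)
  \<comment> \<open>\<open>tl\<close> removes the starting 0, so the remaining vertices 1, ..., m, 0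
    are distinct.\<close>
  then have "distinct (tl (pre_digraph.awalk_verts ?T 0 ?p))"
    by (simp add: upt_conv_Cons del: upt_Suc)
  ultimately have "pre_digraph.cycle ?T ?p"
    unfolding pre_digraph.cycle_def by blast
  moreover have "tail ?T ` set ?p = verts ?T"
    using m by (auto simp: image_image lessThan_Suc atLeast0LessThan)
  ultimately show ?thesis
    unfolding hamiltonian_def by blast
qed

theorem mainTheorem3:
  fixes k l :: nat
  assumes "1 \<le> l" and "l \<le> k" and "6 \<le> k + l"
  shows "(\<exists>D :: (nat, nat \<times> nat) pre_digraph.
            digraph D \<and> hamiltonian D \<and> C_free k l D \<and>
            chromatic_number (underlying_graph D) = k + l - 1 \<and>
            \<not> degenerate (k + l - 3) (underlying_graph D)) \<and>
         (\<forall>T :: ('a, 'b) pre_digraph.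
            tournament T \<and> hamiltonian T \<and> card (verts T) = k + l - 1 \<longrightarrow>
            digraph T \<and> hamiltonian T \<and> C_free k l T \<and>
            chromatic_number (underlying_graph T) = k + l - 1 \<and>
            \<not> degenerate (k + l - 3) (underlying_graph T))"
proof -
  \<comment> \<open>The fresh type variables let this fact serve both the arbitrary \<open>T\<close>
    of the second conjunct and the concrete tournament on naturals of the first. Non-degeneracy
    holds since \<open>Suc (k + l - 3)\<close> is k + l - 2, one below the number of
    vertices.\<close>
  have tight: "digraph T \<and> C_free k l T \<and> chromatic_number (underlying_graph T) = k + l - 1 \<and>
      \<not> degenerate (k + l - 3) (underlying_graph T)"
    if T: "tournament T" and card: "card (verts T) = k + l - 1" for T :: "('c, 'd) pre_digraph"
  proof -
    interpret digraph T
      using T by (simp add: tournament_def)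
    have "complete_digraph (k + l - 1) (underlying_graph T)"
      using complete_underlying_graph_tournament[OF T] card by simp
    moreover have "C_free k l T"
      using assms card by (intro C_free_if_card_verts_less) auto
    ultimately show ?thesis
      using assms digraph_axioms
      by (auto simp: chromatic_number_complete_digraph not_degenerate_complete_digraph)
  qed
  \<comment> \<open>The witness is \<open>back_tournament (k + l - 1)\<close>; it has at least 5
    vertices, so its Hamiltonian cycle exists.\<close>
  show ?thesis
    using tight tight[OF tournament_back_tournament, of "k + l - 1"]
      hamiltonian_back_tournament[of "k + l - 1"] assms
    by auto
qed

end
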